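(* Let $(X,d)$ be a hyperbolic metric space, $o\in X$, $b>1$ a parameter admitting a visual metric $D=D_{b,o}$ on $\partial X$, and let $G\le\mathrm{Isom}(X)$ be a strongly discrete group of general type. Fix a point $\xi\in\partial X$. Then for every $\sigma>0$ there exists a number $C=C_\sigma>0$ such that for every $\eta\in\Lambda_{r,\sigma}(G)$, $$D(g(\xi),\eta)\le C\,b^{-d(o,g(o))}\quad\text{for infinitely many } g\in G.$$ Furthermore, there exists a sequence $(g_n)_1^\infty$ in $G$ such that $g_n(\xi)\to\eta$ and $g_n(o)\to\eta$ as $n\to\infty$, and such that $D(g_n(\xi),\eta)\le C\,b^{-d(o,g_n(o))}$ for all $n\in\mathbb N$.
   Context: For a metric space $(X,d)$ let $\langle x|y\rangle_z=\frac12[d(x,z)+d(y,z)-d(x,y)]$. $(X,d)$ is (Gromov) hyperbolic if there is $C\ge 0$ with $\langle x|z\rangle_w\ge\min(\langle x|y\rangle_w,\langle y|z\rangle_w)-C$ for all $x,y,z,w\in X$ ($X$ need not be proper or geodesic). Fix a basepoint $o\in X$. A sequence $(x_n)$ in $X$ is a Gromov sequence if $\langle x_n|x_m\rangle_o\to\infty$ as $n,m\to\infty$; two Gromov sequences are equivalent if $\langle x_n|y_n\rangle_o\to\infty$; the Gromov boundary $\partial X$ is the set of equivalence classes, and isometries of $X$ act on it. For $\xi,\eta\in\partial X$ and $y,z\in X$: $\langle\xi|\eta\rangle_z=\inf\{\liminf_{n,m\to\infty}\langle x_n|y_m\rangle_z:(x_n)\in\xi,(y_m)\in\eta\}$ and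 $\langle\xi|y\rangle_z=\langle y|\xi\rangle_z=\inf\{\liminf_{n\to\infty}\langle x_n|y\rangle_z:(x_n)\in\xi\}$. A sequence $(x_n)$ in $X\cup\partial X$ converges to $\xi\in\partial X$ iff $\langle x_n|\xi\rangle_o\to\infty$. The parameter $b>1$ is close enough to $1$ that there is a complete metric $D=D_{b,o}$ on $\partial X$ (a visual metric) with $C^{-1}b^{-\langle\xi|\eta\rangle_o}\le D(\xi,\eta)\le Cb^{-\langle\xi|\eta\rangle_o}$ for some constant $C\geq 1$; such a $D$ is fixed. $G\le\mathrm{Isom}(X)$ is strongly discrete if $\{g\in G:d(o,g(o))\le r\}$ is finite for every $r>0$. An isometry $g$ is loxodromic if it has two fixed points $g_+,g_-\in\partial X$ such that for every neighborhood $U$ of $g_-$ the iterates $g^n$ converge to $g_+$ uniformly on $\partial X\setminus U$, and $g^{-1}$ has the same property (with $g_+$ and $g_-$ exchanged). $G$ is of general type if it contains two loxodromic isometries with disjoint fixed-point sets in $\partial X$. For $\sigma>0$, the $\sigma$-radial limit set $\Lambda_{r,\sigma}(G)$ is the set of $\eta\in\partial X$ for which there is a sequence $(h_n)_1^\infty$ in $G$ with $h_n(o)\to\eta$ and $\langle o|\eta\rangle_{h_n(o)}\le\sigma$ for all $n$. *)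

theory Defs
  imports "HOL-Analysis.Analysis" "HOL-Algebra.Group"
begin

section \<open>Gromov hyperbolic metric spaces\<close>

definition gromov_prod :: "'a::metric_space \<Rightarrow> 'a \<Rightarrow> 'a \<Rightarrow> real" where
  "gromov_prod x y z = (dist x z + dist y z - dist x y) / 2"

definition gromov_hyperbolic :: "'a::metric_space itself \<Rightarrow> bool" where
  "gromov_hyperbolic _ \<longleftrightarrow>
     (\<exists>C\<ge>0. \<forall>x y z w :: 'a.
        gromov_prod x z w \<ge> min (gromov_prod x y w) (gromov_prod y z w) - C)"

section \<open>The Gromov boundary\<close>

definition gromov_seqs :: "'a::metric_space \<Rightarrow> (nat \<Rightarrow> 'a) set" where
  "gromov_seqs p =
     {x. filterlim (\<lambda>(n, m). gromov_prod (x n) (x m) p) at_top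
           (sequentially \<times>\<^sub>F sequentially)}"

definition gromov_rel :: "'a::metric_space \<Rightarrow> ((nat \<Rightarrow> 'a) \<times> (nat \<Rightarrow> 'a)) set" where
  "gromov_rel p =
     {(x, y). x \<in> gromov_seqs p \<and> y \<in> gromov_seqs p \<and>
        filterlim (\<lambda>n. gromov_prod (x n) (y n) p) at_top sequentially}"

definition gromov_boundary :: "'a::metric_space \<Rightarrow> (nat \<Rightarrow> 'a) set set" where
  "gromov_boundary p = gromov_seqs p // gromov_rel p"

text \<open>The products below are extended reals: for instance the product of a
  boundary point with itself is infinite.\<close>

definition gromov_prod_bb ::
    "(nat \<Rightarrow> 'a::metric_space) set \<Rightarrow> (nat \<Rightarrow> 'a) set \<Rightarrow> 'a \<Rightarrow> ereal" where
  "gromov_prod_bb \<xi> \<eta> z =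
     (INF x\<in>\<xi>. INF y\<in>\<eta>.
        Liminf (sequentially \<times>\<^sub>F sequentially)
          (\<lambda>(n, m). ereal (gromov_prod (x n) (y m) z)))"

definition gromov_prod_pb ::
    "'a::metric_space \<Rightarrow> (nat \<Rightarrow> 'a) set \<Rightarrow> 'a \<Rightarrow> ereal" where
  "gromov_prod_pb y \<xi> z = (INF x\<in>\<xi>. liminf (\<lambda>n. ereal (gromov_prod (x n) y z)))"

text \<open>Convergence to a boundary point, for sequences of points of the space and for
  sequences of boundary points; \<open>p\<close> is the basepoint.\<close>

definition points_converge ::
    "'a::metric_space \<Rightarrow> (nat \<Rightarrow> 'a) \<Rightarrow> (nat \<Rightarrow> 'a) set \<Rightarrow> bool" where
  "points_converge p x \<xi> \<longleftrightarrow> (\<lambda>n. gromov_prod_pb (x n) \<xi> p) \<longlonglongrightarrow> \<infinity>"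

definition boundary_converge ::
    "'a::metric_space \<Rightarrow> (nat \<Rightarrow> (nat \<Rightarrow> 'a) set) \<Rightarrow> (nat \<Rightarrow> 'a) set \<Rightarrow> bool" where
  "boundary_converge p \<zeta> \<xi> \<longleftrightarrow> (\<lambda>n. gromov_prod_bb (\<zeta> n) \<xi> p) \<longlonglongrightarrow> \<infinity>"

section \<open>Visual metrics\<close>

text \<open>The number $b^{-t}$ for $t \in [0, \infty]$, with $b^{-\infty} = 0$. Gromov products
  are nonnegative, so the value at $-\infty$ plays no role.\<close>

definition powr_uminus :: "real \<Rightarrow> ereal \<Rightarrow> real" where
  "powr_uminus b t = (if t = \<infinity> then 0 else b powr (- real_of_ereal t))"

definition visual_metric ::
    "real \<Rightarrow> 'a::metric_space \<Rightarrow> (nat \<Rightarrow> 'a) set metric \<Rightarrow> bool" where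
  "visual_metric b p D \<longleftrightarrow>
     mspace D = gromov_boundary p \<and> mcomplete_of D \<and>
     (\<exists>C\<ge>1. \<forall>\<xi>\<in>gromov_boundary p. \<forall>\<eta>\<in>gromov_boundary p.
        inverse C * powr_uminus b (gromov_prod_bb \<xi> \<eta> p) \<le> mdist D \<xi> \<eta> \<and>
        mdist D \<xi> \<eta> \<le> C * powr_uminus b (gromov_prod_bb \<xi> \<eta> p))"

section \<open>Groups of isometries\<close>

definition isom_group :: "('a::metric_space \<Rightarrow> 'a) monoid" where
  "isom_group =
     \<lparr>carrier = {g. bij g \<and> (\<forall>x y. dist (g x) (g y) = dist x y)},
      mult = (\<circ>), one = id\<rparr>"

lemma group_isom_group: "group (isom_group :: ('a::metric_space \<Rightarrow> 'a) monoid)"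
proof (rule groupI)
  fix g :: "'a \<Rightarrow> 'a"
  assume g: "g \<in> carrier isom_group"
  let ?h = "inv_into UNIV g"
  have b: "bij g" and i: "\<And>x y. dist (g x) (g y) = dist x y"
    using g by (auto simp: isom_group_def)
  have gh: "g (?h x) = x" for x
    using b by (simp add: bij_is_surj surj_f_inv_f)
  have hg: "?h (g x) = x" for x
    using b by (simp add: bij_is_inj)
  have "dist (?h x) (?h y) = dist x y" for x y
    using i[of "?h x" "?h y"] by (simp add: gh)
  then have "?h \<in> carrier isom_group"
    using b by (simp add: isom_group_def bij_imp_bij_inv)
  moreover have "?h \<otimes>\<^bsub>isom_group\<^esub> g = \<one>\<^bsub>isom_group\<^esub>"
    by (simp add: isom_group_def fun_eq_iff hg)
  ultimately show "\<exists>h\<in>carrier isom_group. h \<otimes>\<^bsub>isom_group\<^esub> g = \<one>\<^bsub>isom_group\<^esub>"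
    by blast
qed (auto simp: isom_group_def bij_comp comp_assoc)

text \<open>The action on the boundary: a bijective isometry maps equivalence classes of
  Gromov sequences onto equivalence classes.\<close>

definition boundary_act ::
    "('a::metric_space \<Rightarrow> 'a) \<Rightarrow> (nat \<Rightarrow> 'a) set \<Rightarrow> (nat \<Rightarrow> 'a) set" where
  "boundary_act g \<xi> = (\<lambda>x. g \<circ> x) ` \<xi>"

definition boundary_fixpoints ::
    "'a::metric_space \<Rightarrow> ('a \<Rightarrow> 'a) \<Rightarrow> (nat \<Rightarrow> 'a) set set" where
  "boundary_fixpoints p g = {\<xi> \<in> gromov_boundary p. boundary_act g \<xi> = \<xi>}"

definition strongly_discrete :: "'a::metric_space \<Rightarrow> ('a \<Rightarrow> 'a) set \<Rightarrow> bool" where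
  "strongly_discrete p G \<longleftrightarrow> (\<forall>r>0. finite {g \<in> G. dist p (g p) \<le> r})"

text \<open>For every neighbourhood \<open>U\<close> of \<open>a\<close>, the iterates of \<open>g\<close> converge to \<open>c\<close> uniformly on
  the complement of \<open>U\<close> in the boundary; topology and uniformity are those of \<open>D\<close>.\<close>

definition uniformly_attracts ::
    "(nat \<Rightarrow> 'a::metric_space) set metric \<Rightarrow> ('a \<Rightarrow> 'a) \<Rightarrow>
     (nat \<Rightarrow> 'a) set \<Rightarrow> (nat \<Rightarrow> 'a) set \<Rightarrow> bool" where
  "uniformly_attracts D g a c \<longleftrightarrow>
     (\<forall>U. (\<exists>V. openin (mtopology_of D) V \<and> a \<in> V \<and> V \<subseteq> U) \<longrightarrow>
        (\<forall>\<epsilon>>0. \<exists>N. \<forall>n\<ge>N. \<forall>\<zeta>\<in>mspace D - U.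
           mdist D (boundary_act (g ^^ n) \<zeta>) c < \<epsilon>))"

definition loxodromic ::
    "'a::metric_space \<Rightarrow> (nat \<Rightarrow> 'a) set metric \<Rightarrow> ('a \<Rightarrow> 'a) \<Rightarrow> bool" where
  "loxodromic p D g \<longleftrightarrow>
     g \<in> carrier isom_group \<and>
     (\<exists>gp\<in>boundary_fixpoints p g. \<exists>gm\<in>boundary_fixpoints p g. gp \<noteq> gm \<and>
        uniformly_attracts D g gm gp \<and>
        uniformly_attracts D (inv_into UNIV g) gp gm)"

definition general_type ::
    "'a::metric_space \<Rightarrow> (nat \<Rightarrow> 'a) set metric \<Rightarrow> ('a \<Rightarrow> 'a) set \<Rightarrow> bool" where
  "general_type p D G \<longleftrightarrow>
     (\<exists>g\<in>G. \<exists>h\<in>G. loxodromic p D g \<and> loxodromic p D h \<and>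
        boundary_fixpoints p g \<inter> boundary_fixpoints p h = {})"

definition radial_limit_set ::
    "'a::metric_space \<Rightarrow> real \<Rightarrow> ('a \<Rightarrow> 'a) set \<Rightarrow> (nat \<Rightarrow> 'a) set set" where
  "radial_limit_set p \<sigma> G =
     {\<eta> \<in> gromov_boundary p.
        \<exists>h. (\<forall>n. h n \<in> G) \<and> points_converge p (\<lambda>n. h n p) \<eta> \<and>
            (\<forall>n. gromov_prod_pb p \<eta> (h n p) \<le> ereal \<sigma>)}"

end

theory Submission
  imports Defs
begin

text \<open>Only one consequence of general type matters: some \<open>f \<in> G\<close> moves \<open>\<xi>\<close>, because two
  loxodromic elements with disjoint fixed point sets cannot both fix \<open>\<xi>\<close>. Since \<open>\<xi>\<close> and \<open>f \<xi>\<close>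
  are distinct, their Gromov product is finite, so by hyperbolicity there is a number \<open>\<tau>\<close> such
  that every point \<open>z\<close> of the space satisfies \<open>\<langle>\<zeta>|z\<rangle>\<^sub>p \<le> \<tau>\<close> for at least one
  \<open>\<zeta> \<in> {\<xi>, f \<xi>}\<close> (lemma \<open>two_boundary_points_shadow\<close>).

  Let \<open>h \<in> G\<close> be one of the elements that exhibit \<open>\<eta>\<close> as a \<open>\<sigma>\<close>-radial limit point, so that
  \<open>\<langle>p|\<eta>\<rangle>\<close> based at \<open>h p\<close> is at most \<open>\<sigma>\<close>. Choosing \<open>\<zeta>\<close> for the point \<open>z = h\<^sup>-\<^sup>1 p\<close> makes
  \<open>\<langle>h \<zeta>|p\<rangle>\<close> based at \<open>h p\<close> at most \<open>\<tau>\<close> as well. The identity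
  \<open>\<langle>x|y\<rangle>\<^sub>p = \<langle>x|y\<rangle>\<^sub>q + d(p,q) - \<langle>x|p\<rangle>\<^sub>q - \<langle>y|p\<rangle>\<^sub>q\<close> with \<open>q = h p\<close> then shows
  that \<open>\<langle>h \<zeta>|\<eta>\<rangle>\<^sub>p\<close> is at least \<open>d(p, h p)\<close> up to an additive constant. Here \<open>h \<zeta> = g \<xi>\<close>
  with \<open>g = h\<close> or \<open>g = h f\<close>, and \<open>d(p, g p)\<close> differs from \<open>d(p, h p)\<close> by at most
  \<open>d(p, f p)\<close>, so the visual metric turns this into the required estimate. As \<open>h\<close> runs through
  the radial sequence, \<open>d(p, h p)\<close> tends to infinity, which gives both convergence statements and
  infinitely many different \<open>g\<close>.\<close>

section \<open>Gromov products of points\<close>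

lemma gromov_prod_commute: "gromov_prod x y z = gromov_prod y x z"
  by (simp add: gromov_prod_def dist_commute)

lemma gromov_prod_nonneg: "0 \<le> gromov_prod x y z"
  using dist_triangle2[of x y z] by (simp add: gromov_prod_def)

lemma gromov_prod_le_dist: "gromov_prod x y z \<le> dist y z"
  using dist_triangle[of x z y] by (simp add: gromov_prod_def)

lemma gromov_prod_change_basepoint:
  "gromov_prod x y p =
     gromov_prod x y q + dist p q - gromov_prod x p q - gromov_prod y p q"
  by (simp add: gromov_prod_def dist_commute field_simps)

lemma gromov_prod_basepoint_Lipschitz: "gromov_prod x y q \<ge> gromov_prod x y p - dist p q"
  using dist_triangle[of x p q] dist_triangle[of y p q]
  by (simp add: gromov_prod_def dist_commute field_simps)

lemma gromov_prod_Lipschitz: "gromov_prod x y p - dist y z \<le> gromov_prod x z p"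
  using dist_triangle[of x z y] dist_triangle[of y p z]
  by (simp add: gromov_prod_def dist_commute field_simps)

lemma gromov_prod_isometry:
  assumes "\<And>x y. dist (g x) (g y) = dist x y"
  shows "gromov_prod (g x) (g y) (g z) = gromov_prod x y z"
  using assms by (simp add: gromov_prod_def)

section \<open>Sequences converging to a boundary point\<close>

lemma filterlim_isometry_gromov_prod:
  fixes g :: "'a::metric_space \<Rightarrow> 'a" and F :: "'b filter"
  assumes iso: "\<And>x y. dist (g x) (g y) = dist x y"
  shows "filterlim (\<lambda>i. gromov_prod (g (a i)) (g (b i)) p) at_top F \<longleftrightarrow>
         filterlim (\<lambda>i. gromov_prod (a i) (b i) p) at_top F"
proof -
  have eq: "gromov_prod (g (a i)) (g (b i)) (g p) = gromov_prod (a i) (b i) p" for i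
    by (rule gromov_prod_isometry[OF iso])
  have bounds: "gromov_prod (a i) (b i) p \<ge> gromov_prod (g (a i)) (g (b i)) p - dist p (g p)"
    "gromov_prod (g (a i)) (g (b i)) p \<ge> gromov_prod (a i) (b i) p - dist (g p) p" for i
    unfolding eq[of i, symmetric] by (rule gromov_prod_basepoint_Lipschitz)+
  have *: "filterlim u at_top F"
    if "filterlim v at_top F" and "\<And>i. u i \<ge> v i - c" for u v :: "'b \<Rightarrow> real" and c
  proof -
    have "filterlim (\<lambda>i. - c + v i) at_top F"
      using that(1) filterlim_tendsto_add_at_top tendsto_const by blast
    then show ?thesis
      by (rule filterlim_at_top_mono) (use that(2) in \<open>simp add: algebra_simps\<close>)
  qed
  show ?thesis
    using *[where v="\<lambda>i. gromov_prod (g (a i)) (g (b i)) p" and u="\<lambda>i. gromov_prod (a i) (b i) p",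
        OF _ bounds(1)]
      *[where v="\<lambda>i. gromov_prod (a i) (b i) p" and u="\<lambda>i. gromov_prod (g (a i)) (g (b i)) p",
        OF _ bounds(2)]
    by blast
qed

lemma isometry_comp_in_gromov_seqs_iff:
  assumes "\<And>x y. dist (g x) (g y) = dist x y"
  shows "g \<circ> x \<in> gromov_seqs p \<longleftrightarrow> x \<in> gromov_seqs p"
  using filterlim_isometry_gromov_prod[OF assms, of "\<lambda>(n, m). x n" "\<lambda>(n, m). x m"]
  by (simp add: gromov_seqs_def case_prod_unfold)

lemma isometry_comp_in_gromov_rel_iff:
  assumes "\<And>x y. dist (g x) (g y) = dist x y"
  shows "(g \<circ> x, g \<circ> y) \<in> gromov_rel p \<longleftrightarrow> (x, y) \<in> gromov_rel p"
  using isometry_comp_in_gromov_seqs_iff[OF assms]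
    filterlim_isometry_gromov_prod[OF assms, of x y p sequentially]
  by (simp add: gromov_rel_def)

lemma boundary_act_in_gromov_boundary:
  assumes bij: "bij g" and iso: "\<And>x y. dist (g x) (g y) = dist x y"
    and \<xi>: "\<xi> \<in> gromov_boundary p"
  shows "boundary_act g \<xi> \<in> gromov_boundary p"
proof -
  obtain x where x: "x \<in> gromov_seqs p" and eq: "\<xi> = gromov_rel p `` {x}"
    using \<xi> by (auto simp: gromov_boundary_def quotient_def)
  have "boundary_act g \<xi> = gromov_rel p `` {g \<circ> x}"
  proof
    show "boundary_act g \<xi> \<subseteq> gromov_rel p `` {g \<circ> x}"
      using isometry_comp_in_gromov_rel_iff[OF iso] by (auto simp: boundary_act_def eq)
    show "gromov_rel p `` {g \<circ> x} \<subseteq> boundary_act g \<xi>"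
    proof
      fix y assume y: "y \<in> gromov_rel p `` {g \<circ> x}"
      have "y = g \<circ> (inv_into UNIV g \<circ> y)"
        using bij by (simp add: fun_eq_iff bij_is_surj surj_f_inv_f)
      moreover from this y have "inv_into UNIV g \<circ> y \<in> \<xi>"
        using isometry_comp_in_gromov_rel_iff[OF iso, of x "inv_into UNIV g \<circ> y" p] by (simp add: eq)
      ultimately show "y \<in> boundary_act g \<xi>"
        by (auto simp: boundary_act_def)
    qed
  qed
  then show ?thesis
    using x isometry_comp_in_gromov_seqs_iff[OF iso]
    by (auto simp: gromov_boundary_def quotient_def)
qed

lemma gromov_boundary_nonempty:
  assumes "\<xi> \<in> gromov_boundary p"
  shows "\<xi> \<noteq> {}"
proof -
  obtain x where x: "x \<in> gromov_seqs p" and eq: "\<xi> = gromov_rel p `` {x}"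
    using assms by (auto simp: gromov_boundary_def quotient_def)
  have "filterlim (\<lambda>n. (n, n)) (sequentially \<times>\<^sub>F sequentially) (sequentially :: nat filter)"
    by (intro filterlim_Pair filterlim_ident)
  then have "filterlim (\<lambda>n. gromov_prod (x n) (x n) p) at_top sequentially"
    using x filterlim_compose unfolding gromov_seqs_def by fastforce
  then show ?thesis
    using x by (auto simp: eq gromov_rel_def)
qed

text \<open>Two representatives of the same boundary point have mixed products tending to infinity,
  with respect to any basepoint.\<close>

lemma gromov_prod_representatives_unbounded:
  fixes p :: "'a::metric_space"
  assumes hyp: "\<And>x y z w :: 'a.
      gromov_prod x z w \<ge> min (gromov_prod x y w) (gromov_prod y z w) - \<delta>"
    and \<xi>: "\<xi> \<in> gromov_boundary p" and x: "x \<in> \<xi>" and y: "y \<in> \<xi>"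
  shows "\<exists>N. \<forall>n\<ge>N. \<forall>m\<ge>N. M \<le> gromov_prod (x n) (y m) w"
proof -
  obtain s where s: "s \<in> gromov_seqs p" and eq: "\<xi> = gromov_rel p `` {s}"
    using \<xi> by (auto simp: gromov_boundary_def quotient_def)
  define L where "L = M + dist p w + 2 * \<bar>\<delta>\<bar>"
  have "filterlim (\<lambda>n. gromov_prod (s n) (x n) p) at_top sequentially"
    and "filterlim (\<lambda>n. gromov_prod (s n) (y n) p) at_top sequentially"
    using x y by (auto simp: eq gromov_rel_def)
  then have "eventually (\<lambda>n. L \<le> gromov_prod (s n) (x n) p) sequentially"
    and "eventually (\<lambda>n. L \<le> gromov_prod (s n) (y n) p) sequentially"
    by (auto simp: filterlim_at_top)
  then obtain N1 N2 where N1: "\<And>n. n \<ge> N1 \<Longrightarrow> L \<le> gromov_prod (s n) (x n) p"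
    and N2: "\<And>n. n \<ge> N2 \<Longrightarrow> L \<le> gromov_prod (s n) (y n) p"
    unfolding eventually_sequentially by blast
  have "eventually (\<lambda>(n, m). L \<le> gromov_prod (s n) (s m) p) (sequentially \<times>\<^sub>F sequentially)"
    using s by (auto simp: gromov_seqs_def filterlim_at_top case_prod_unfold)
  then obtain N3 where N3: "\<And>n m. n \<ge> N3 \<Longrightarrow> m \<ge> N3 \<Longrightarrow> L \<le> gromov_prod (s n) (s m) p"
    by (auto simp: eventually_prod_sequentially)
  have "M \<le> gromov_prod (x n) (y m) w"
    if "n \<ge> max N1 (max N2 N3)" "m \<ge> max N1 (max N2 N3)" for n m
  proof -
    have "gromov_prod (x n) (y m) p \<ge> L - 2 * \<bar>\<delta>\<bar>"
      using hyp[of "x n" "s n" p "y m"] hyp[of "s n" "s m" p "y m"]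
        N1[of n] N2[of m] N3[of n m] that gromov_prod_commute[of "s n" "x n" p]
      by linarith
    then show ?thesis
      using gromov_prod_basepoint_Lipschitz[where x="x n" and y="y m" and p=p and q=w]
      by (simp add: L_def)
  qed
  then show ?thesis by blast
qed

section \<open>Gromov products with boundary points\<close>

lemma gromov_prod_pb_le_dist:
  assumes "\<xi> \<noteq> {}"
  shows "gromov_prod_pb y \<xi> z \<le> ereal (dist y z)"
proof -
  obtain x where x: "x \<in> \<xi>" using assms by blast
  have "gromov_prod_pb y \<xi> z \<le> liminf (\<lambda>n. ereal (gromov_prod (x n) y z))"
    unfolding gromov_prod_pb_def using x by (rule INF_lower)
  also have "\<dots> \<le> liminf (\<lambda>n. ereal (dist y z))"
    by (intro Liminf_mono always_eventually allI) (simp add: gromov_prod_le_dist)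
  finally show ?thesis by (simp add: Liminf_const)
qed

lemma gromov_prod_pb_Lipschitz:
  assumes "ereal r \<le> gromov_prod_pb x \<xi> p"
  shows "ereal (r - dist x y) \<le> gromov_prod_pb y \<xi> p"
  unfolding gromov_prod_pb_def
proof (rule INF_greatest)
  fix s assume s: "s \<in> \<xi>"
  have r: "ereal r \<le> liminf (\<lambda>n. ereal (gromov_prod (s n) x p))"
    using assms INF_lower[OF s] unfolding gromov_prod_pb_def by (rule order_trans)
  have "ereal (r - dist x y) = ereal r + ereal (- dist x y)"
    by simp
  also have "\<dots> \<le> liminf (\<lambda>n. ereal (gromov_prod (s n) x p)) + ereal (- dist x y)"
    using r by (rule add_right_mono)
  also have "\<dots> = liminf (\<lambda>n. ereal (gromov_prod (s n) x p) + ereal (- dist x y))"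
    by (rule Liminf_add_ereal_right[symmetric]) auto
  also have "\<dots> \<le> liminf (\<lambda>n. ereal (gromov_prod (s n) y p))"
    using gromov_prod_Lipschitz
    by (intro Liminf_mono always_eventually allI) (simp add: algebra_simps)
  finally show "ereal (r - dist x y) \<le> liminf (\<lambda>n. ereal (gromov_prod (s n) y p))" .
qed

lemma points_converge_bounded_distance:
  assumes conv: "points_converge p x \<xi>" and near: "\<And>n. dist (x n) (y n) \<le> r"
  shows "points_converge p y \<xi>"
  unfolding points_converge_def tendsto_PInfty
proof
  fix t :: real
  have "eventually (\<lambda>n. ereal (t + r + 1) < gromov_prod_pb (x n) \<xi> p) sequentially"
    using conv by (simp add: points_converge_def tendsto_PInfty)
  then show "eventually (\<lambda>n. ereal t < gromov_prod_pb (y n) \<xi> p) sequentially"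
  proof eventually_elim
    case (elim n)
    have "ereal t < ereal (t + r + 1 - dist (x n) (y n))"
      using near[of n] by simp
    also have "\<dots> \<le> gromov_prod_pb (y n) \<xi> p"
      using elim by (intro gromov_prod_pb_Lipschitz) auto
    finally show ?case .
  qed
qed

lemma points_converge_imp_dist_at_top:
  assumes "points_converge p x \<xi>" and "\<xi> \<noteq> {}"
  shows "filterlim (\<lambda>n. dist (x n) p) at_top sequentially"
  unfolding filterlim_at_top
proof
  fix t :: real
  have "eventually (\<lambda>n. ereal t < gromov_prod_pb (x n) \<xi> p) sequentially"
    using assms by (simp add: points_converge_def tendsto_PInfty)
  then show "eventually (\<lambda>n. t \<le> dist (x n) p) sequentially"
  proof eventually_elim
    case (elim n)
    also have "gromov_prod_pb (x n) \<xi> p \<le> ereal (dist (x n) p)"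
      using assms(2) by (rule gromov_prod_pb_le_dist)
    finally show ?case by simp
  qed
qed

text \<open>The infimum over representatives costs only an additive constant: a bound on the product
  with a boundary point controls every representing sequence.\<close>

lemma gromov_prod_pb_bound_all_representatives:
  fixes p :: "'a::metric_space"
  assumes hyp: "\<And>x y z w :: 'a.
      gromov_prod x z w \<ge> min (gromov_prod x y w) (gromov_prod y z w) - \<delta>"
    and \<xi>: "\<xi> \<in> gromov_boundary p" and bound: "gromov_prod_pb q \<xi> w \<le> ereal s"
    and x: "x \<in> \<xi>"
  shows "eventually (\<lambda>n. gromov_prod (x n) q w \<le> s + 1 + \<delta>) sequentially"
proof -
  have "gromov_prod_pb q \<xi> w < ereal (s + 1)"
    using bound by (rule order_le_less_trans) simp
  then obtain y where y: "y \<in> \<xi>"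
    and "liminf (\<lambda>n. ereal (gromov_prod (y n) q w)) < ereal (s + 1)"
    unfolding gromov_prod_pb_def INF_less_iff by blast
  then have "\<not> eventually (\<lambda>n. ereal (s + 1) \<le> ereal (gromov_prod (y n) q w)) sequentially"
    using Liminf_bounded by (metis leD)
  then have freq: "\<exists>k\<ge>N. gromov_prod (y k) q w < s + 1" for N
    by (auto simp: eventually_sequentially not_le)
  obtain N where N: "\<And>n m. n \<ge> N \<Longrightarrow> m \<ge> N \<Longrightarrow> s + 2 + \<delta> \<le> gromov_prod (y n) (x m) w"
    using gromov_prod_representatives_unbounded[OF hyp \<xi> y x] by blast
  obtain k where "k \<ge> N" and k: "gromov_prod (y k) q w < s + 1"
    using freq by blast
  have "gromov_prod (x n) q w \<le> s + 1 + \<delta>" if "n \<ge> N" for n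
    using hyp[of "y k" "x n" w q] N[OF \<open>k \<ge> N\<close> that] k by linarith
  then show ?thesis
    unfolding eventually_sequentially by blast
qed

text \<open>Two boundary points with finite product cannot both lie in the direction of the same
  point \<open>z\<close> as seen from \<open>p\<close>, with a bound uniform in \<open>z\<close>.\<close>

lemma two_boundary_points_shadow:
  fixes p :: "'a::metric_space"
  assumes hyp: "\<And>x y z w :: 'a.
      gromov_prod x z w \<ge> min (gromov_prod x y w) (gromov_prod y z w) - \<delta>"
    and fin: "gromov_prod_bb \<xi> \<zeta> p \<noteq> \<infinity>"
  shows "\<exists>\<tau>. \<forall>z. gromov_prod_pb z \<xi> p \<le> ereal \<tau> \<or> gromov_prod_pb z \<zeta> p \<le> ereal \<tau>"
proof -
  obtain K where "gromov_prod_bb \<xi> \<zeta> p < ereal K"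
    using fin less_PInf_Ex_of_nat by auto
  then obtain x y where x: "x \<in> \<xi>" and y: "y \<in> \<zeta>"
    and "Liminf (sequentially \<times>\<^sub>F sequentially)
           (\<lambda>(n, m). ereal (gromov_prod (x n) (y m) p)) < ereal K"
    unfolding gromov_prod_bb_def INF_less_iff by blast
  then have freq: "\<not> eventually (\<lambda>(n, m). ereal K \<le> ereal (gromov_prod (x n) (y m) p))
      (sequentially \<times>\<^sub>F sequentially)"
    using Liminf_bounded[of "ereal K" "\<lambda>(n, m). ereal (gromov_prod (x n) (y m) p)"]
    by (auto simp: case_prod_unfold dest: leD)
  have "gromov_prod_pb z \<xi> p \<le> ereal (K + \<delta>) \<or> gromov_prod_pb z \<zeta> p \<le> ereal (K + \<delta>)" for z
  proof (rule ccontr)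
    assume "\<not> ?thesis"
    then have "ereal (K + \<delta>) < gromov_prod_pb z \<xi> p" "ereal (K + \<delta>) < gromov_prod_pb z \<zeta> p"
      by auto
    then have "ereal (K + \<delta>) < liminf (\<lambda>n. ereal (gromov_prod (x n) z p))"
      and "ereal (K + \<delta>) < liminf (\<lambda>n. ereal (gromov_prod (y n) z p))"
      unfolding gromov_prod_pb_def using x y by (auto intro: less_INF_D)
    then have "eventually (\<lambda>n. K + \<delta> < gromov_prod (x n) z p) sequentially"
      and "eventually (\<lambda>n. K + \<delta> < gromov_prod (y n) z p) sequentially"
      by (auto dest: less_LiminfD)
    then have "eventually (\<lambda>(n, m). K + \<delta> < gromov_prod (x n) z p \<and>
        K + \<delta> < gromov_prod (y m) z p) (sequentially \<times>\<^sub>F sequentially)"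
      by (auto simp: case_prod_unfold intro: eventually_prodI)
    then have "eventually (\<lambda>(n, m). ereal K \<le> ereal (gromov_prod (x n) (y m) p))
        (sequentially \<times>\<^sub>F sequentially)"
    proof (rule eventually_mono, clarsimp)
      fix n m
      assume "K + \<delta> < gromov_prod (x n) z p" "K + \<delta> < gromov_prod (y m) z p"
      then show "K \<le> gromov_prod (x n) (y m) p"
        using hyp[of "x n" z p "y m"] gromov_prod_commute[of "y m" z p] by linarith
    qed
    then show False using freq by blast
  qed
  then show ?thesis by blast
qed

text \<open>If \<open>p\<close> has bounded products with both \<open>\<zeta>\<close> and \<open>\<eta>\<close> when based at \<open>q\<close>, then heuristically
  rays from \<open>p\<close> towards \<open>\<zeta>\<close> and \<open>\<eta>\<close> stay together roughly from \<open>p\<close> to \<open>q\<close>.\<close>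

lemma gromov_prod_bb_ge_dist:
  fixes p :: "'a::metric_space"
  assumes hyp: "\<And>x y z w :: 'a.
      gromov_prod x z w \<ge> min (gromov_prod x y w) (gromov_prod y z w) - \<delta>"
    and \<zeta>: "\<zeta> \<in> gromov_boundary p" "gromov_prod_pb p \<zeta> q \<le> ereal \<tau>"
    and \<eta>: "\<eta> \<in> gromov_boundary p" "gromov_prod_pb p \<eta> q \<le> ereal \<sigma>"
  shows "ereal (dist p q - (\<tau> + \<sigma> + 2 + 2 * \<delta>)) \<le> gromov_prod_bb \<zeta> \<eta> p"
  unfolding gromov_prod_bb_def
proof (intro INF_greatest Liminf_bounded)
  fix x y assume x: "x \<in> \<zeta>" and y: "y \<in> \<eta>"
  have "eventually (\<lambda>(n, m). gromov_prod (x n) p q \<le> \<tau> + 1 + \<delta> \<and>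
      gromov_prod (y m) p q \<le> \<sigma> + 1 + \<delta>) (sequentially \<times>\<^sub>F sequentially)"
    using eventually_prodI[OF gromov_prod_pb_bound_all_representatives[OF hyp \<zeta> x]
        gromov_prod_pb_bound_all_representatives[OF hyp \<eta> y]]
    by (simp add: case_prod_unfold)
  then show "eventually (\<lambda>i. ereal (dist p q - (\<tau> + \<sigma> + 2 + 2 * \<delta>)) \<le>
      (case i of (n, m) \<Rightarrow> ereal (gromov_prod (x n) (y m) p)))
      (sequentially \<times>\<^sub>F sequentially)"
  proof (rule eventually_mono, clarsimp)
    fix n m
    assume "gromov_prod (x n) p q \<le> \<tau> + 1 + \<delta>" "gromov_prod (y m) p q \<le> \<sigma> + 1 + \<delta>"
    then show "dist p q - (\<tau> + \<sigma> + 2 + 2 * \<delta>) \<le> gromov_prod (x n) (y m) p"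
      using gromov_prod_change_basepoint[of "x n" "y m" p q] gromov_prod_nonneg[of "x n" "y m" q]
      by linarith
  qed
qed

lemma gromov_prod_pb_boundary_act:
  assumes "\<And>x y. dist (g x) (g y) = dist x y"
  shows "gromov_prod_pb (g y) (boundary_act g \<xi>) (g z) = gromov_prod_pb y \<xi> z"
  by (simp add: gromov_prod_pb_def boundary_act_def image_image gromov_prod_isometry[OF assms])

lemma boundary_act_comp: "boundary_act (g \<circ> h) \<xi> = boundary_act g (boundary_act h \<xi>)"
  by (simp add: boundary_act_def image_image comp_assoc)

lemma boundary_act_id: "boundary_act id \<xi> = \<xi>"
  by (simp add: boundary_act_def)

section \<open>Approximation of radial limit points by an orbit\<close>

lemma visual_metric_finite_gromov_prod:
  assumes "visual_metric b p D" and "\<xi> \<in> gromov_boundary p" and "\<eta> \<in> gromov_boundary p"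
    and "\<xi> \<noteq> \<eta>"
  shows "gromov_prod_bb \<xi> \<eta> p \<noteq> \<infinity>"
proof
  assume inf: "gromov_prod_bb \<xi> \<eta> p = \<infinity>"
  obtain C where "mdist D \<xi> \<eta> \<le> C * powr_uminus b (gromov_prod_bb \<xi> \<eta> p)"
    using assms by (auto simp: visual_metric_def)
  then have "mdist D \<xi> \<eta> = 0"
    using inf mdist_nonneg[of D \<xi> \<eta>] by (simp add: powr_uminus_def)
  then show False
    using assms by (simp add: visual_metric_def)
qed

lemma powr_uminus_le:
  assumes "b > 1" and "ereal r \<le> t"
  shows "powr_uminus b t \<le> b powr (- r)"
  using assms by (cases t) (auto simp: powr_uminus_def)

theorem theorem3p1:
  fixes p :: "'a::metric_space" and b :: real
    and D :: "(nat \<Rightarrow> 'a) set metric"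
    and G :: "('a \<Rightarrow> 'a) set" and \<xi> :: "(nat \<Rightarrow> 'a) set"
  assumes "gromov_hyperbolic TYPE('a)"
    and "b > 1"
    and "visual_metric b p D"
    and "subgroup G isom_group"
    and "strongly_discrete p G"
    and "general_type p D G"
    and "\<xi> \<in> gromov_boundary p"
  shows "\<forall>\<sigma>>0. \<exists>C>0. \<forall>\<eta>\<in>radial_limit_set p \<sigma> G.
           infinite {g \<in> G. mdist D (boundary_act g \<xi>) \<eta> \<le> C * b powr (- dist p (g p))} \<and>
           (\<exists>g. (\<forall>n. g n \<in> G) \<and>
                boundary_converge p (\<lambda>n. boundary_act (g n) \<xi>) \<eta> \<and>
                points_converge p (\<lambda>n. g n p) \<eta> \<and>
                (\<forall>n. mdist D (boundary_act (g n) \<xi>) \<eta> \<le> C * b powr (- dist p (g n p))))"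
proof (intro allI impI)
  fix \<sigma> :: real assume "\<sigma> > 0"
  obtain \<delta> where hyp: "\<And>x y z w :: 'a.
      gromov_prod x z w \<ge> min (gromov_prod x y w) (gromov_prod y z w) - \<delta>"
    using assms(1) by (auto simp: gromov_hyperbolic_def)
  have iso: "\<And>g x y. g \<in> G \<Longrightarrow> dist (g x) (g y) = dist x y" and bij: "\<And>g. g \<in> G \<Longrightarrow> bij g"
    using subgroup.subset[OF assms(4)] by (auto simp: isom_group_def)
  have comp: "g \<circ> h \<in> G" if "g \<in> G" "h \<in> G" for g h
    using subgroup.m_closed[OF assms(4) that] by (simp add: isom_group_def)
  have id: "id \<in> G"
    using subgroup.one_closed[OF assms(4)] by (simp add: isom_group_def)
  have act: "boundary_act g \<zeta> \<in> gromov_boundary p"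
    if "g \<in> G" "\<zeta> \<in> gromov_boundary p" for g \<zeta>
    using that by (intro boundary_act_in_gromov_boundary bij iso)
  \<comment> \<open>of two loxodromic elements without common fixed points, at least one moves \<open>\<xi>\<close>\<close>
  obtain f where f: "f \<in> G" and "boundary_act f \<xi> \<noteq> \<xi>"
    using assms(6,7) unfolding general_type_def boundary_fixpoints_def by blast
  then have "gromov_prod_bb \<xi> (boundary_act f \<xi>) p \<noteq> \<infinity>"
    using visual_metric_finite_gromov_prod[OF assms(3,7) act[OF f assms(7)]] by simp
  then obtain \<tau> where \<tau>: "\<And>z. gromov_prod_pb z \<xi> p \<le> ereal \<tau> \<or>
      gromov_prod_pb z (boundary_act f \<xi>) p \<le> ereal \<tau>"
    using two_boundary_points_shadow[OF hyp] by blast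
  obtain A where "A \<ge> 1" and visual: "\<And>\<zeta> \<eta>. \<zeta> \<in> gromov_boundary p \<Longrightarrow>
      \<eta> \<in> gromov_boundary p \<Longrightarrow> mdist D \<zeta> \<eta> \<le> A * powr_uminus b (gromov_prod_bb \<zeta> \<eta> p)"
    using assms(3) unfolding visual_metric_def by blast
  define B where "B = \<tau> + \<sigma> + 2 + 2 * \<delta>"
  define C where "C = A * b powr (B + dist p (f p))"
  have "C > 0"
    using \<open>A \<ge> 1\<close> assms(2) by (simp add: C_def)
  show "\<exists>C>0. \<forall>\<eta>\<in>radial_limit_set p \<sigma> G.
           infinite {g \<in> G. mdist D (boundary_act g \<xi>) \<eta> \<le> C * b powr (- dist p (g p))} \<and>
           (\<exists>g. (\<forall>n. g n \<in> G) \<and>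
                boundary_converge p (\<lambda>n. boundary_act (g n) \<xi>) \<eta> \<and>
                points_converge p (\<lambda>n. g n p) \<eta> \<and>
                (\<forall>n. mdist D (boundary_act (g n) \<xi>) \<eta> \<le> C * b powr (- dist p (g n p))))"
  proof (rule exI[of _ C], intro conjI \<open>C > 0\<close> ballI)
    fix \<eta> assume "\<eta> \<in> radial_limit_set p \<sigma> G"
    then obtain h where \<eta>: "\<eta> \<in> gromov_boundary p" and h: "\<And>n. h n \<in> G"
      and h_conv: "points_converge p (\<lambda>n. h n p) \<eta>"
      and h_rad: "\<And>n. gromov_prod_pb p \<eta> (h n p) \<le> ereal \<sigma>"
      by (auto simp: radial_limit_set_def)
    \<comment> \<open>correct \<open>h n\<close> on the right by \<open>id\<close> or \<open>f\<close>, so that its image of \<open>\<xi>\<close> lies near \<open>\<eta>\<close>\<close>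
    have "\<exists>k\<in>{id, f}. gromov_prod_pb (inv_into UNIV (h n) p) (boundary_act k \<xi>) p \<le> ereal \<tau>" for n
      using \<tau> by (auto simp: boundary_act_id)
    then obtain k where k: "\<And>n. k n \<in> {id, f}"
      and k_shadow: "\<And>n. gromov_prod_pb (inv_into UNIV (h n) p) (boundary_act (k n) \<xi>) p \<le> ereal \<tau>"
      by metis
    define g where "g n = h n \<circ> k n" for n
    have kG: "k n \<in> G" and k_dist: "dist p (k n p) \<le> dist p (f p)" for n
      using k[of n] f id by auto
    have g: "g n \<in> G" for n
      by (simp add: g_def comp h kG)
    have near: "dist (h n p) (g n p) \<le> dist p (f p)" for n
      using k_dist[of n] by (simp add: g_def iso h)
    have g_conv: "points_converge p (\<lambda>n. g n p) \<eta>"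
      using h_conv near by (rule points_converge_bounded_distance)
    have prod: "ereal (dist p (h n p) - B) \<le> gromov_prod_bb (boundary_act (g n) \<xi>) \<eta> p" for n
      unfolding B_def
    proof (rule gromov_prod_bb_ge_dist[OF hyp act[OF g assms(7)] _ \<eta> h_rad])
      have "h n (inv_into UNIV (h n) p) = p"
        using bij[OF h] by (simp add: bij_is_surj surj_f_inv_f)
      then show "gromov_prod_pb p (boundary_act (g n) \<xi>) (h n p) \<le> ereal \<tau>"
        using k_shadow[of n]
          gromov_prod_pb_boundary_act[OF iso[OF h], of n "inv_into UNIV (h n) p" "boundary_act (k n) \<xi>" p]
        by (simp add: g_def boundary_act_comp)
    qed
    have est: "mdist D (boundary_act (g n) \<xi>) \<eta> \<le> C * b powr (- dist p (g n p))" for n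
    proof -
      have "mdist D (boundary_act (g n) \<xi>) \<eta>
          \<le> A * powr_uminus b (gromov_prod_bb (boundary_act (g n) \<xi>) \<eta> p)"
        by (intro visual act g assms(7) \<eta>)
      also have "\<dots> \<le> A * b powr (- (dist p (h n p) - B))"
        using powr_uminus_le[OF assms(2) prod] \<open>A \<ge> 1\<close> by (intro mult_left_mono) auto
      also have "\<dots> \<le> A * b powr (B + dist p (f p) + - dist p (g n p))"
        using \<open>A \<ge> 1\<close> assms(2) near[of n] dist_triangle[of p "g n p" "h n p"]
        by (intro mult_left_mono powr_mono) auto
      also have "\<dots> = C * b powr (- dist p (g n p))"
        by (simp only: C_def powr_add mult.assoc)
      finally show ?thesis .
    qed
    have dist_h: "filterlim (\<lambda>n. dist p (h n p)) at_top sequentially"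
      and dist_g: "filterlim (\<lambda>n. dist p (g n p)) at_top sequentially"
      using points_converge_imp_dist_at_top[OF h_conv gromov_boundary_nonempty[OF \<eta>]]
        points_converge_imp_dist_at_top[OF g_conv gromov_boundary_nonempty[OF \<eta>]]
      by (simp_all add: dist_commute)
    have "boundary_converge p (\<lambda>n. boundary_act (g n) \<xi>) \<eta>"
      unfolding boundary_converge_def tendsto_PInfty
    proof
      fix t :: real
      have "eventually (\<lambda>n. t + B + 1 \<le> dist p (h n p)) sequentially"
        using dist_h by (simp add: filterlim_at_top)
      then show "eventually (\<lambda>n. ereal t < gromov_prod_bb (boundary_act (g n) \<xi>) \<eta> p) sequentially"
      proof eventually_elim
        case (elim n)
        then have "ereal t < ereal (dist p (h n p) - B)" by simp
        also note prod[of n]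
        finally show ?case .
      qed
    qed
    with g g_conv est show "\<exists>g. (\<forall>n. g n \<in> G) \<and>
        boundary_converge p (\<lambda>n. boundary_act (g n) \<xi>) \<eta> \<and> points_converge p (\<lambda>n. g n p) \<eta> \<and>
        (\<forall>n. mdist D (boundary_act (g n) \<xi>) \<eta> \<le> C * b powr (- dist p (g n p)))"
      by blast
    show "infinite {g \<in> G. mdist D (boundary_act g \<xi>) \<eta> \<le> C * b powr (- dist p (g p))}"
      (is "infinite ?S")
    proof
      assume fin: "finite ?S"
      define M where "M = Max ((\<lambda>g. dist p (g p)) ` ?S)"
      have "dist p (g n p) \<le> M" for n
        unfolding M_def using fin g est by (intro Max_ge) auto
      moreover have "eventually (\<lambda>n. M + 1 \<le> dist p (g n p)) sequentially"
        using dist_g by (simp add: filterlim_at_top)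
      then obtain n where "M + 1 \<le> dist p (g n p)"
        by (auto simp: eventually_sequentially)
      ultimately show False
        by (metis add_le_same_cancel1 not_one_le_zero order_trans)
    qed
  qed
qed

end
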